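(* For every sufficiently small $\epsilon>0$ there is $\delta>0$ such that for every initial data $\alpha(0)\in h^1$ with $\|\alpha(0)-A(0)\|_{h^1}\le\delta$, where $A_n(0)=\delta_{n0}$, the corresponding unique solution $\alpha(t)\in C(\mathbb{R},h^1)$ of the conformal flow system $$i(n+1)\frac{d\alpha_n}{dt}=\sum_{j=0}^{\infty}\sum_{k=0}^{n+j}S_{njk,n+j-k}\,\bar\alpha_j\alpha_k\alpha_{n+j-k},\qquad n\in\mathbb{N},$$ satisfies for all $t\in\mathbb{R}$ $$\mathrm{dist}_{h^1}(\alpha(t),\mathcal{A}(0))\le\epsilon.$$
   Context: $\mathbb{N}=\{0,1,2,\dots\}$; $S_{njk,n+j-k}=\min(n,j,k,n+j-k)+1$; $h^1$ is the space of complex sequences with finite norm $\|\alpha\|_{h^1}^2=\sum_{n\ge0}(n+1)^2|\alpha_n|^2$. For every $\alpha(0)\in h^1$ the system has a unique global solution in $C(\mathbb{R},h^1)$. The orbit $\mathcal{A}(0)$ is the set of sequences $(e^{i\theta+i\mu n}A_n(0))_{n\in\mathbb{N}}$ with $\theta,\mu\in\mathbb{S}^1=\mathbb{R}/2\pi\mathbb{Z}$ (which here equals $\{e^{i\theta}A(0)\}$), and $\mathrm{dist}_{h^1}(\alpha,\mathcal{A}(0))=\inf_{\theta,\mu}\|\alpha-(e^{i\theta+i\mu n}A_n(0))_{n}\|_{h^1}$. *)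

theory Defs
  imports "HOL-Analysis.Analysis"
begin

definition h1 :: "(nat \<Rightarrow> complex) set" where
  "h1 = {\<alpha>. summable (\<lambda>n. (real n + 1)^2 * (cmod (\<alpha> n))^2)}"

(* Meaningful only on h1, where the series converges. *)
definition h1_norm :: "(nat \<Rightarrow> complex) \<Rightarrow> real" where
  "h1_norm \<alpha> = sqrt (\<Sum>n. (real n + 1)^2 * (cmod (\<alpha> n))^2)"

definition h1_continuous :: "(real \<Rightarrow> nat \<Rightarrow> complex) \<Rightarrow> bool" where
  "h1_continuous \<alpha> \<longleftrightarrow>
     (\<forall>t. \<alpha> t \<in> h1) \<and>
     (\<forall>t. ((\<lambda>s. h1_norm (\<lambda>n. \<alpha> s n - \<alpha> t n)) \<longlongrightarrow> 0) (at t))"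

definition S_coeff :: "nat \<Rightarrow> nat \<Rightarrow> nat \<Rightarrow> nat \<Rightarrow> nat" where
  "S_coeff n j k m = Min {n, j, k, m} + 1"

(* The system is read componentwise, for a curve in C(R, h1). Since k ranges up to n + j,
   the natural number subtraction n + j - k never truncates. *)
definition conformal_flow_solution :: "(real \<Rightarrow> nat \<Rightarrow> complex) \<Rightarrow> bool" where
  "conformal_flow_solution \<alpha> \<longleftrightarrow>
     h1_continuous \<alpha> \<and>
     (\<forall>t n. (\<lambda>s. \<alpha> s n) differentiable (at t) \<and>
        (\<lambda>j. \<Sum>k = 0..n + j. of_nat (S_coeff n j k (n + j - k)) *
                 cnj (\<alpha> t j) * \<alpha> t k * \<alpha> t (n + j - k))
        sums (\<i> * of_nat (n + 1) * vector_derivative (\<lambda>s. \<alpha> s n) (at t)))"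

(* The angles in R/2 pi Z are represented by arbitrary reals. *)
definition orbit :: "(nat \<Rightarrow> complex) \<Rightarrow> (nat \<Rightarrow> complex) set" where
  "orbit A = {(\<lambda>n. exp (\<i> * of_real \<theta> + \<i> * of_real \<mu> * of_nat n) * A n) | \<theta> \<mu> :: real. True}"

definition h1_dist :: "(nat \<Rightarrow> complex) \<Rightarrow> (nat \<Rightarrow> complex) set \<Rightarrow> real" where
  "h1_dist \<alpha> B = (INF \<beta>\<in>B. h1_norm (\<lambda>n. \<alpha> n - \<beta> n))"

definition ground_state :: "nat \<Rightarrow> complex" where
  "ground_state n = (if n = 0 then 1 else 0)"

end

theory Submission
  imports Defs
begin

text \<open>For affine weights \<open>w\<close> the quantity \<open>\<Sum>n. w n * (n+1) * |\<alpha> n|\<^sup>2\<close> is conserved, since the resonance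
  condition \<open>n + j = k + m\<close> and the symmetries of the coefficients make its time derivative vanish.
  Taking \<open>w n = n\<close>, the conserved quantity vanishes at the ground state and controls the squared
  norm of the modes \<open>n \<ge> 1\<close> for all times; taking \<open>w n = 1\<close> then keeps the modulus of
  the zeroth mode close to \<open>1\<close>, and its phase is absorbed by the orbit.\<close>

section \<open>The squared norm on \<open>h1\<close> and its boundedness along continuous
  curves\<close>

definition h1_energy :: "(nat \<Rightarrow> complex) \<Rightarrow> real" where
  "h1_energy a = (\<Sum>n. (real n + 1)^2 * (cmod (a n))^2)"

lemma h1_norm_eq: "h1_norm a = sqrt (h1_energy a)"
  by (simp add: h1_norm_def h1_energy_def)

lemma h1_energy_nonneg: "a \<in> h1 \<Longrightarrow> 0 \<le> h1_energy a"
  unfolding h1_energy_def h1_def by (intro suminf_nonneg) auto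

lemma cmod_add_sq_le: "(cmod (x + y))^2 \<le> 2 * (cmod x)^2 + 2 * (cmod y)^2"
proof -
  have "(cmod (x + y))^2 \<le> (cmod x + cmod y)^2"
    by (intro power_mono norm_triangle_ineq) auto
  also have "\<dots> \<le> 2 * (cmod x)^2 + 2 * (cmod y)^2"
    using sum_squares_bound[of "cmod x" "cmod y"] by (simp add: power2_sum)
  finally show ?thesis .
qed

text \<open>Squaring the triangle inequality termwise gives a factor 2 in place of Minkowski's
  inequality; this suffices for boundedness of curves.\<close>

lemma h1_add:
  assumes "a \<in> h1" "b \<in> h1"
  shows "(\<lambda>n. a n + b n) \<in> h1"
    and "h1_energy (\<lambda>n. a n + b n) \<le> 2 * h1_energy a + 2 * h1_energy b"
proof -
  let ?e = "\<lambda>a n. (real n + 1)^2 * (cmod (a n))^2"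
  have a: "summable (?e a)" and b: "summable (?e b)"
    using assms by (auto simp: h1_def)
  have s: "(\<lambda>n. 2 * ?e a n + 2 * ?e b n) sums (2 * h1_energy a + 2 * h1_energy b)"
    unfolding h1_energy_def by (intro sums_add sums_mult summable_sums a b)
  have le: "?e (\<lambda>n. a n + b n) n \<le> 2 * ?e a n + 2 * ?e b n" for n
    using mult_left_mono[OF cmod_add_sq_le[of "a n" "b n"], of "(real n + 1)^2"]
    by (simp add: algebra_simps)
  have sm: "summable (?e (\<lambda>n. a n + b n))"
    by (rule summable_comparison_test'[OF sums_summable[OF s], of 0]) (use le in auto)
  then show "(\<lambda>n. a n + b n) \<in> h1" by (simp add: h1_def)
  show "h1_energy (\<lambda>n. a n + b n) \<le> 2 * h1_energy a + 2 * h1_energy b"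
    unfolding sums_unique[OF s] h1_energy_def[of "\<lambda>n. a n + b n"]
    by (intro suminf_le le sm sums_summable[OF s])
qed

lemma h1_uminus: "a \<in> h1 \<Longrightarrow> (\<lambda>n. - a n) \<in> h1"
  by (simp add: h1_def)

lemma h1_diff: "a \<in> h1 \<Longrightarrow> b \<in> h1 \<Longrightarrow> (\<lambda>n. a n - b n) \<in> h1"
  using h1_add(1)[OF _ h1_uminus] by simp

text \<open>Near \<open>t\<close> the difference to \<open>\<alpha> t\<close> has energy below 1,
  and \<open>h1_add\<close> turns this into the stated bound.\<close>

lemma h1_continuous_locally_bounded:
  assumes "h1_continuous \<alpha>"
  shows "\<exists>d>0. \<forall>s. \<bar>s - t\<bar> < d \<longrightarrow> h1_energy (\<alpha> s) \<le> 2 + 2 * h1_energy (\<alpha> t)"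
proof -
  have h: "\<alpha> s \<in> h1" for s using assms by (simp add: h1_continuous_def)
  have "((\<lambda>s. h1_norm (\<lambda>n. \<alpha> s n - \<alpha> t n)) \<longlongrightarrow> 0) (at t)"
    using assms by (simp add: h1_continuous_def)
  then have "\<forall>\<^sub>F s in at t. h1_norm (\<lambda>n. \<alpha> s n - \<alpha> t n) < 1"
    by (rule order_tendstoD) simp
  then obtain d where d: "d > 0"
    "\<And>s. s \<noteq> t \<Longrightarrow> dist s t < d \<Longrightarrow> h1_norm (\<lambda>n. \<alpha> s n - \<alpha> t n) < 1"
    unfolding eventually_at by auto
  have "h1_energy (\<alpha> s) \<le> 2 + 2 * h1_energy (\<alpha> t)" if "\<bar>s - t\<bar> < d" for s
  proof (cases "s = t")
    case True
    then show ?thesis using h1_energy_nonneg[OF h, of t] by simp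
  next
    case False
    then have "h1_norm (\<lambda>n. \<alpha> s n - \<alpha> t n) < 1"
      using d(2)[of s] that by (simp add: dist_real_def)
    then have "h1_energy (\<lambda>n. \<alpha> s n - \<alpha> t n) < 1"
      unfolding h1_norm_eq by simp
    then show ?thesis
      using h1_add(2)[OF h1_diff[OF h[of s] h[of t]] h[of t]] by simp
  qed
  with d(1) show ?thesis by blast
qed

text \<open>Local bounds are glued by bisection. The result is the a priori bound that dominates the
  time derivatives before any conservation law is available.\<close>

lemma h1_continuous_bounded:
  assumes "h1_continuous \<alpha>" "a \<le> b"
  shows "\<exists>M. \<forall>s\<in>{a..b}. h1_energy (\<alpha> s) \<le> M"
  using assms(2)
proof (induction rule: Bolzano)
  case (trans a b c)
  then obtain M M' where
    "\<forall>s\<in>{a..b}. h1_energy (\<alpha> s) \<le> M" "\<forall>s\<in>{b..c}. h1_energy (\<alpha> s) \<le> M'" by blast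
  then have "\<forall>s\<in>{a..c}. h1_energy (\<alpha> s) \<le> max M M'"
    by (metis atLeastAtMost_iff le_cases le_max_iff_disj)
  then show ?case by blast
next
  case (local x)
  obtain d where d: "d > 0"
    "\<And>s. \<bar>s - x\<bar> < d \<Longrightarrow> h1_energy (\<alpha> s) \<le> 2 + 2 * h1_energy (\<alpha> x)"
    using h1_continuous_locally_bounded[OF assms(1)] by blast
  have "\<exists>M. \<forall>s\<in>{a..b}. h1_energy (\<alpha> s) \<le> M" if "a \<le> x \<and> x \<le> b \<and> b - a < d" for a b
    using that by (intro exI[of _ "2 + 2 * h1_energy (\<alpha> x)"] ballI d(2)) auto
  with d(1) show ?case by blast
qed

section \<open>Embedding of \<open>h1\<close> into the absolutely summable sequences\<close>

definition inv_sq_sum :: real where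
  "inv_sq_sum = (\<Sum>n. inverse ((real n + 1)^2))"

lemma summable_inv_sq: "summable (\<lambda>n. inverse ((real n + 1)^2))"
proof -
  have "summable (\<lambda>n. inverse (of_nat (Suc n) ^ 2 :: real))"
    using inverse_power_summable[of 2, where 'a = real] by (subst summable_Suc_iff) auto
  then show ?thesis by (simp add: add.commute)
qed

text \<open>The arithmetic-geometric mean inequality is applied to \<open>(n+1) |a n|\<close> and
  \<open>1/(n+1)\<close>, whose product is \<open>|a n|\<close>.\<close>

lemma h1_abs_summable:
  assumes "a \<in> h1"
  shows "summable (\<lambda>n. cmod (a n))"
    and "(\<Sum>n. cmod (a n)) \<le> (h1_energy a + inv_sq_sum) / 2"
proof -
  let ?f = "\<lambda>n. ((real n + 1)^2 * (cmod (a n))^2 + inverse ((real n + 1)^2)) / 2"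
  have s: "?f sums ((h1_energy a + inv_sq_sum) / 2)"
    unfolding h1_energy_def inv_sq_sum_def
    using assms by (intro sums_divide sums_add summable_sums summable_inv_sq) (simp add: h1_def)
  have le: "cmod (a n) \<le> ?f n" for n
  proof -
    have "2 * ((real n + 1) * cmod (a n)) * inverse (real n + 1)
        \<le> ((real n + 1) * cmod (a n))^2 + (inverse (real n + 1))^2"
      by (rule sum_squares_bound)
    moreover have "2 * ((real n + 1) * cmod (a n)) * inverse (real n + 1) = 2 * cmod (a n)"
      by (simp add: field_simps)
    ultimately show ?thesis
      by (simp add: power_mult_distrib power_inverse)
  qed
  show sm: "summable (\<lambda>n. cmod (a n))"
    by (rule summable_comparison_test'[OF sums_summable[OF s], of 0]) (use le in auto)
  show "(\<Sum>n. cmod (a n)) \<le> (h1_energy a + inv_sq_sum) / 2"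
    unfolding sums_unique[OF s] by (intro suminf_le le sm sums_summable[OF s])
qed

section \<open>Absolute summability of the resonant interactions\<close>

text \<open>This is the \<open>j\<close>-th term of the \<open>n\<close>-th equation, multiplied by
  \<open>w n * cnj (a n)\<close>. Along a solution, the sum over \<open>j\<close> of its imaginary
  part is half the time derivative of \<open>w n * (n+1) * |a n|^2\<close>.\<close>

definition resonance :: "(nat \<Rightarrow> real) \<Rightarrow> (nat \<Rightarrow> complex) \<Rightarrow> nat \<Rightarrow> nat \<Rightarrow> complex" where
  "resonance w a n j = of_real (w n) * cnj (a n) *
     (\<Sum>k = 0..n + j. of_nat (S_coeff n j k (n + j - k)) * cnj (a j) * a k * a (n + j - k))"

lemma S_coeff_le: "S_coeff n j k m \<le> j + 1"
  by (simp add: S_coeff_def)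

text \<open>The first symmetry justifies the exchange of \<open>n\<close> and \<open>N - n\<close>
  on a diagonal, the second makes the quadratic form there Hermitian.\<close>

lemma S_coeff_swap: "S_coeff j n k m = S_coeff n j k m" "S_coeff k m n j = S_coeff n j k m"
  by (simp_all add: S_coeff_def insert_commute)

text \<open>The two growing factors are shared out: the weight costs \<open>n + 1\<close>, charged
  to mode \<open>n\<close>, and the coefficient costs at most \<open>j + 1\<close>, charged to mode
  \<open>j\<close>. Each is just what \<open>h1\<close> affords.\<close>

lemma cmod_resonance_le:
  assumes "\<bar>w n\<bar> \<le> real n + 1"
  shows "cmod (resonance w a n j) \<le> ((real n + 1) * cmod (a n)) * ((real j + 1) * cmod (a j)) *
    (\<Sum>k\<le>n + j. cmod (a k) * cmod (a (n + j - k)))"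
proof -
  have "cmod (\<Sum>k = 0..n + j. of_nat (S_coeff n j k (n + j - k)) * cnj (a j) * a k * a (n + j - k))
     \<le> (\<Sum>k = 0..n + j. ((real j + 1) * cmod (a j)) * (cmod (a k) * cmod (a (n + j - k))))"
  proof (rule sum_norm_le)
    fix k
    have "real (S_coeff n j k (n + j - k)) \<le> real j + 1"
      using S_coeff_le[of n j k "n + j - k"] by linarith
    then have "real (S_coeff n j k (n + j - k)) * (cmod (a j) * (cmod (a k) * cmod (a (n + j - k))))
        \<le> (real j + 1) * (cmod (a j) * (cmod (a k) * cmod (a (n + j - k))))"
      by (intro mult_right_mono) auto
    then show "cmod (of_nat (S_coeff n j k (n + j - k)) * cnj (a j) * a k * a (n + j - k))
       \<le> ((real j + 1) * cmod (a j)) * (cmod (a k) * cmod (a (n + j - k)))"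
      by (simp add: norm_mult mult.assoc)
  qed
  also have "\<dots> = ((real j + 1) * cmod (a j)) * (\<Sum>k\<le>n + j. cmod (a k) * cmod (a (n + j - k)))"
    by (simp add: sum_distrib_left atLeast0AtMost)
  finally have "\<bar>w n\<bar> * cmod (a n) * cmod (\<Sum>k = 0..n + j.
      of_nat (S_coeff n j k (n + j - k)) * cnj (a j) * a k * a (n + j - k))
    \<le> (real n + 1) * cmod (a n) *
      (((real j + 1) * cmod (a j)) * (\<Sum>k\<le>n + j. cmod (a k) * cmod (a (n + j - k))))"
    using assms by (intro mult_mono) auto
  then show ?thesis
    by (simp add: resonance_def norm_mult mult.assoc)
qed

text \<open>Summing along the diagonals \<open>n + j = N\<close>, the convolution of \<open>(n+1) |a n|\<close> with itself is
  bounded by the energy, and the remaining factor is the convolution square of a summable sequence.\<close>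
lemma sum_cmod_resonance_le:
  assumes a: "a \<in> h1" and w: "\<And>n. \<bar>w n\<bar> \<le> real n + 1" and F: "finite F"
  shows "(\<Sum>(n, j)\<in>F. cmod (resonance w a n j)) \<le> h1_energy a * (\<Sum>n. cmod (a n))^2"
proof -
  let ?b = "\<lambda>n. (real n + 1) * cmod (a n)"
  let ?c = "\<lambda>N. \<Sum>k\<le>N. cmod (a k) * cmod (a (N - k))"
  have b2: "summable (\<lambda>n. (?b n)^2)" and E: "h1_energy a = (\<Sum>n. (?b n)^2)"
    using a by (simp_all add: h1_def h1_energy_def power_mult_distrib)
  have l1: "summable (\<lambda>n. norm (cmod (a n)))"
    using h1_abs_summable(1)[OF a] by simp
  have c0: "0 \<le> ?c N" for N by (intro sum_nonneg) auto
  have conv: "(\<Sum>n\<le>N. ?b n * ?b (N - n)) \<le> h1_energy a" for N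
  proof -
    have "(\<Sum>n\<le>N. ?b n * ?b (N - n)) \<le> (\<Sum>n\<le>N. ((?b n)^2 + (?b (N - n))^2) / 2)"
    proof (rule sum_mono)
      have "x * y \<le> (x^2 + y^2) / 2" for x y :: real
        using sum_squares_bound[of x y] by simp
      then show "?b n * ?b (N - n) \<le> ((?b n)^2 + (?b (N - n))^2) / 2" for n .
    qed
    also have "\<dots> = ((\<Sum>n\<le>N. (?b n)^2) + (\<Sum>n\<le>N. (?b (N - n))^2)) / 2"
      by (simp only: sum.distrib flip: sum_divide_distrib)
    also have "(\<Sum>n\<le>N. (?b (N - n))^2) = (\<Sum>n\<le>N. (?b n)^2)"
      by (rule sum.nat_diff_reindex[of _ "Suc N", unfolded lessThan_Suc_atMost, simplified])
    also have "((\<Sum>n\<le>N. (?b n)^2) + (\<Sum>n\<le>N. (?b n)^2)) / 2 \<le> h1_energy a"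
      unfolding E by (simp, intro sum_le_suminf b2) auto
    finally show ?thesis .
  qed
  \<comment> \<open>The finite set is enlarged to a triangle \<open>n + j < M\<close>, which is a
    union of full diagonals.\<close>
  obtain M where "(\<lambda>(n, j). n + j) ` F \<subseteq> {..<M}"
    using finite_nat_iff_bounded F finite_imageI by metis
  then have FM: "F \<subseteq> {(n, j). n + j < M}" by auto
  have fin: "finite {(n, j). n + j < (M::nat)}"
    by (rule finite_subset[of _ "{..<M} \<times> {..<M}"]) auto
  have "(\<Sum>(n, j)\<in>F. cmod (resonance w a n j))
      \<le> (\<Sum>(n, j)\<in>F. ?b n * ?b j * ?c (n + j))"
    by (rule sum_mono) (auto intro: cmod_resonance_le w)
  also have "\<dots> \<le> (\<Sum>(n, j)\<in>{(n, j). n + j < M}. ?b n * ?b j * ?c (n + j))"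
    by (rule sum_mono2[OF fin FM]) (auto intro!: mult_nonneg_nonneg sum_nonneg)
  also have "\<dots> = (\<Sum>N<M. \<Sum>n\<le>N. ?b n * ?b (N - n) * ?c (n + (N - n)))"
    by (rule sum.triangle_reindex)
  also have "\<dots> = (\<Sum>N<M. (\<Sum>n\<le>N. ?b n * ?b (N - n)) * ?c N)"
    unfolding sum_distrib_right by (intro sum.cong refl) simp
  also have "\<dots> \<le> (\<Sum>N<M. h1_energy a * ?c N)"
    by (intro sum_mono mult_right_mono conv c0)
  also have "\<dots> = h1_energy a * (\<Sum>N<M. ?c N)"
    by (simp add: sum_distrib_left)
  also have "\<dots> \<le> h1_energy a * (\<Sum>N. ?c N)"
    using summable_Cauchy_product[OF l1 l1] c0
    by (intro mult_left_mono sum_le_suminf h1_energy_nonneg a) auto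
  also have "(\<Sum>N. ?c N) = (\<Sum>n. cmod (a n))^2"
    unfolding power2_eq_square by (rule Cauchy_product[symmetric, OF l1 l1])
  finally show ?thesis .
qed

text \<open>The bound on finite sums does not depend on the finite set, so the double family is
  absolutely summable and may be summed by rows or by diagonals.\<close>

lemma resonance_summable:
  assumes "a \<in> h1" "\<And>n. \<bar>w n\<bar> \<le> real n + 1"
  shows "(\<lambda>(n, j). resonance w a n j) summable_on UNIV"
proof (rule abs_summable_summable)
  show "(\<lambda>p. norm (case p of (n, j) \<Rightarrow> resonance w a n j)) summable_on UNIV"
    using sum_cmod_resonance_le[of a w] assms
    by (intro nonneg_bdd_above_summable_on bdd_aboveI2) (auto simp: case_prod_unfold)
qed

section \<open>Cancellation of the resonant interactions for affine weights\<close>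

text \<open>Symmetrising in \<open>n \<leftrightarrow> N - n\<close> replaces the weight by the constant \<open>(w 0 + w N) / 2\<close>; what is left
  is a real symmetric quadratic form in the products \<open>a n * a (N - n)\<close>.\<close>
lemma resonance_diagonal:
  assumes w: "\<And>n. n \<le> N \<Longrightarrow> w n + w (N - n) = w 0 + w N"
  shows "Im (\<Sum>n\<le>N. resonance w a n (N - n)) = 0"
proof -
  define s where "s n k = complex_of_nat (S_coeff n (N - n) k (N - k))" for n k
  define g where "g n = a n * a (N - n)" for n
  define q where "q n = (\<Sum>k\<le>N. s n k * cnj (g n) * g k)" for n
  let ?X = "\<Sum>n\<le>N. resonance w a n (N - n)"
  have X: "?X = (\<Sum>n\<le>N. of_real (w n) * q n)"
  proof (rule sum.cong)
    fix n assume "n \<in> {..N}"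
    then show "resonance w a n (N - n) = of_real (w n) * q n"
      by (simp add: resonance_def q_def s_def g_def sum_distrib_left atLeast0AtMost mult_ac)
  qed simp
  have sym: "q (N - n) = q n" if "n \<le> N" for n
  proof -
    have "s (N - n) k = s n k" for k
      using that by (simp add: s_def S_coeff_swap(1))
    then show ?thesis using that by (simp add: q_def g_def mult.commute)
  qed
  have "?X = (\<Sum>n\<le>N. of_real (w (N - n)) * q (N - n))"
    unfolding X
    by (rule sum.nat_diff_reindex[of _ "Suc N", unfolded lessThan_Suc_atMost, simplified, symmetric])
  also have "\<dots> = (\<Sum>n\<le>N. of_real (w (N - n)) * q n)"
    by (intro sum.cong) (auto simp: sym)
  finally have "2 * ?X = (\<Sum>n\<le>N. of_real (w n) * q n) + (\<Sum>n\<le>N. of_real (w (N - n)) * q n)"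
    using X by simp
  also have "\<dots> = (\<Sum>n\<le>N. of_real (w 0 + w N) * q n)"
    unfolding sum.distrib[symmetric]
    by (intro sum.cong) (auto simp: w[symmetric] algebra_simps)
  finally have 2: "2 * ?X = of_real (w 0 + w N) * (\<Sum>n\<le>N. q n)"
    by (simp add: sum_distrib_left)
  \<comment> \<open>Conjugation merely exchanges the two summation indices, so the form equals its
    own conjugate.\<close>
  have "cnj (\<Sum>n\<le>N. q n) = (\<Sum>n\<le>N. \<Sum>k\<le>N. s k n * cnj (g k) * g n)"
    by (simp add: q_def s_def S_coeff_swap(2) mult_ac)
  also have "\<dots> = (\<Sum>n\<le>N. q n)"
    unfolding q_def by (rule sum.swap)
  finally have "Im (\<Sum>n\<le>N. q n) = 0"
    by (metis cnj.sel(2) equal_neg_zero)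
  then have "Im (2 * ?X) = 0"
    unfolding 2 by simp
  then show ?thesis by simp
qed

text \<open>The same total \<open>L\<close> is computed twice: by rows it is the sum in question, by
  diagonals it is a sum of zeros.\<close>

lemma resonance_sums_real:
  assumes a: "a \<in> h1" and w: "\<And>n. \<bar>w n\<bar> \<le> real n + 1"
    and aff: "\<And>N n. n \<le> N \<Longrightarrow> w n + w (N - n) = w 0 + w N"
  shows "(\<lambda>n. \<Sum>j. Im (resonance w a n j)) sums 0"
proof -
  let ?R = "\<lambda>(n, j). resonance w a n j"
  have sR: "?R summable_on UNIV \<times> UNIV"
    using resonance_summable[OF a w] by simp
  then have sI: "(\<lambda>(n, j). Im (resonance w a n j)) summable_on UNIV \<times> UNIV"
    by (drule_tac summable_on_Im) (simp add: case_prod_unfold)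
  then obtain L where L: "((\<lambda>(n, j). Im (resonance w a n j)) has_sum L) (UNIV \<times> UNIV)"
    by (auto simp: summable_on_def)
  have row: "((\<lambda>j. Im (resonance w a n j)) has_sum (\<Sum>j. Im (resonance w a n j))) UNIV" for n
  proof -
    have "(\<lambda>j. Im (resonance w a n j)) summable_on UNIV"
      by (rule summable_on_SigmaD1[OF sI]) simp
    then show ?thesis
      using has_sum_imp_sums sums_unique unfolding summable_on_def by blast
  qed
  have "((\<lambda>n. \<Sum>j. Im (resonance w a n j)) has_sum L) UNIV"
    by (rule has_sum_SigmaD[OF L]) (use row in auto)
  \<comment> \<open>The change of variables \<open>N = n + j\<close> turns the quadrant into a union
    of finite diagonals.\<close>
  moreover have "((\<lambda>(N, n). Im (resonance w a n (N - n))) has_sum L) (SIGMA N:UNIV. {..N})"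
    using L
    by (subst (asm) has_sum_reindex_bij_witness[of _ "\<lambda>(N, n). (n, N - n)" "\<lambda>(n, j). (n + j, n)"
        _ "\<lambda>(N, n). Im (resonance w a n (N - n))" _ L L]) auto
  then have "((\<lambda>N. 0) has_sum L) (UNIV :: nat set)"
  proof (rule has_sum_SigmaD)
    fix N :: nat
    have "(\<Sum>n\<le>N. Im (resonance w a n (N - n))) = 0"
      using resonance_diagonal[of N w a] aff by simp
    then show "((\<lambda>n. case (N, n) of (N, n) \<Rightarrow> Im (resonance w a n (N - n))) has_sum 0) {..N}"
      using has_sum_finite[of "{..N}" "\<lambda>n. Im (resonance w a n (N - n))"] by simp
  qed
  then have "L = 0"
    using has_sum_unique has_sum_0[of UNIV "\<lambda>N::nat. 0::real"] by blast
  ultimately show ?thesis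
    by (auto dest: has_sum_imp_sums)
qed

text \<open>The bound holds on finite rectangles and survives the limit \<open>J\<close> to
  infinity. It is uniform in \<open>M\<close>, as dominated convergence requires.\<close>

lemma resonance_partial_sums_le:
  assumes a: "a \<in> h1" and w: "\<And>n. \<bar>w n\<bar> \<le> real n + 1"
  shows "\<bar>\<Sum>n<M. \<Sum>j. Im (resonance w a n j)\<bar> \<le> h1_energy a * (\<Sum>n. cmod (a n))^2"
proof -
  let ?R = "\<lambda>(n, j). resonance w a n j"
  have row: "summable (\<lambda>j. Im (resonance w a n j))" for n
  proof -
    have "(\<lambda>(n, j). Im (resonance w a n j)) summable_on UNIV \<times> UNIV"
      using summable_on_Im[OF resonance_summable[OF a w]]
      by (simp add: case_prod_unfold)
    then have "(\<lambda>j. Im (resonance w a n j)) summable_on UNIV"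
      by (rule summable_on_SigmaD1) simp
    then show ?thesis by (rule summable_on_imp_summable)
  qed
  have "\<bar>\<Sum>n<M. \<Sum>j<J. Im (resonance w a n j)\<bar> \<le> h1_energy a * (\<Sum>n. cmod (a n))^2" for J
  proof -
    have "\<bar>\<Sum>n<M. \<Sum>j<J. Im (resonance w a n j)\<bar>
        = \<bar>\<Sum>(n, j)\<in>{..<M} \<times> {..<J}. Im (resonance w a n j)\<bar>"
      by (simp add: sum.cartesian_product)
    also have "\<dots> \<le> (\<Sum>(n, j)\<in>{..<M} \<times> {..<J}. cmod (resonance w a n j))"
      by (rule order_trans[OF sum_abs], rule sum_mono) (auto intro: abs_Im_le_cmod)
    also have "\<dots> \<le> h1_energy a * (\<Sum>n. cmod (a n))^2"
      by (rule sum_cmod_resonance_le[OF a w]) simp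
    finally show ?thesis .
  qed
  moreover have "(\<lambda>J. \<bar>\<Sum>n<M. \<Sum>j<J. Im (resonance w a n j)\<bar>)
      \<longlonglongrightarrow> \<bar>\<Sum>n<M. \<Sum>j. Im (resonance w a n j)\<bar>"
    by (intro tendsto_intros summable_LIMSEQ row)
  ultimately show ?thesis
    by (intro LIMSEQ_le_const2) auto
qed

section \<open>Conservation laws of the flow\<close>

lemma has_real_derivative_cmod_sq:
  assumes "(f has_vector_derivative f') (at t)"
  shows "((\<lambda>s. (cmod (f s))^2) has_real_derivative 2 * Re (cnj (f t) * f')) (at t)"
  using assms unfolding cmod_power2
  by (auto intro!: derivative_eq_intros simp: algebra_simps)

text \<open>After multiplication of the equation by \<open>w n * cnj (\<alpha> t n)\<close>, the
  factor \<open>\<i>\<close> makes the imaginary part equal to the real part of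
  \<open>cnj (\<alpha> t n)\<close> times the velocity, up to the weight.\<close>

lemma conformal_flow_mode_derivative:
  assumes "conformal_flow_solution \<alpha>"
  shows "((\<lambda>s. w n * (real n + 1) * (cmod (\<alpha> s n))^2) has_real_derivative
           2 * (\<Sum>j. Im (resonance w (\<alpha> t) n j))) (at t)"
proof -
  let ?v = "vector_derivative (\<lambda>s. \<alpha> s n) (at t)"
  have v: "((\<lambda>s. \<alpha> s n) has_vector_derivative ?v) (at t)"
    using assms by (auto simp: conformal_flow_solution_def vector_derivative_works)
  have "(\<lambda>j. \<Sum>k = 0..n + j. of_nat (S_coeff n j k (n + j - k)) *
                 cnj (\<alpha> t j) * \<alpha> t k * \<alpha> t (n + j - k))
        sums (\<i> * of_nat (n + 1) * ?v)"
    using assms by (auto simp: conformal_flow_solution_def)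
  then have "resonance w (\<alpha> t) n sums (of_real (w n) * cnj (\<alpha> t n) * (\<i> * of_nat (n + 1) * ?v))"
    unfolding resonance_def by (rule sums_mult)
  then have "(\<lambda>j. Im (resonance w (\<alpha> t) n j)) sums
      Im (of_real (w n) * cnj (\<alpha> t n) * (\<i> * of_nat (n + 1) * ?v))"
    by (rule sums_Im)
  moreover have "of_real (w n) * cnj (\<alpha> t n) * (\<i> * of_nat (n + 1) * ?v)
      = of_real (w n * (real n + 1)) * (\<i> * (cnj (\<alpha> t n) * ?v))"
    by (simp add: algebra_simps)
  moreover have "Im (of_real r * (\<i> * z)) = r * Re z" for r z
    by simp
  ultimately have "(\<Sum>j. Im (resonance w (\<alpha> t) n j)) =
      w n * (real n + 1) * Re (cnj (\<alpha> t n) * ?v)"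
    by (metis sums_unique)
  then show ?thesis
    using DERIV_cmult[OF has_real_derivative_cmod_sq[OF v], of "w n * (real n + 1)"]
    by (simp only: mult_ac)
qed

lemma weighted_summable:
  assumes "a \<in> h1" "\<And>n. \<bar>w n\<bar> \<le> real n + 1"
  shows "summable (\<lambda>n. w n * (real n + 1) * (cmod (a n))^2)"
proof (rule summable_comparison_test'[of _ 0])
  show "summable (\<lambda>n. (real n + 1)^2 * (cmod (a n))^2)"
    using assms(1) by (simp add: h1_def)
  fix n
  show "norm (w n * (real n + 1) * (cmod (a n))^2) \<le> (real n + 1)^2 * (cmod (a n))^2"
    using assms(2)[of n] by (auto simp: abs_mult power2_eq_square intro!: mult_right_mono)
qed

text \<open>Termwise differentiation of the series is avoided: the truncations \<open>Q M\<close>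
  are integrated exactly, and dominated convergence sends the integrals of \<open>D M\<close> to
  0.\<close>

lemma conformal_flow_conserved_le:
  assumes sol: "conformal_flow_solution \<alpha>" and w: "\<And>n. \<bar>w n\<bar> \<le> real n + 1"
    and aff: "\<And>N n. n \<le> N \<Longrightarrow> w n + w (N - n) = w 0 + w N" and "a \<le> b"
  shows "(\<Sum>n. w n * (real n + 1) * (cmod (\<alpha> a n))^2) = (\<Sum>n. w n * (real n + 1) * (cmod (\<alpha> b n))^2)"
proof -
  define Q where "Q M t = (\<Sum>n<M. w n * (real n + 1) * (cmod (\<alpha> t n))^2)" for M t
  define D where "D M t = 2 * (\<Sum>n<M. \<Sum>j. Im (resonance w (\<alpha> t) n j))" for M t
  have cont: "h1_continuous \<alpha>" and h: "\<alpha> t \<in> h1" for t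
    using sol by (auto simp: conformal_flow_solution_def h1_continuous_def)
  obtain B where B: "\<And>t. t \<in> {a..b} \<Longrightarrow> h1_energy (\<alpha> t) \<le> B"
    using h1_continuous_bounded[OF cont \<open>a \<le> b\<close>] by blast
  have B0: "0 \<le> B" using B[of a] h1_energy_nonneg[OF h, of a] \<open>a \<le> b\<close> by auto
  have "(Q M has_vector_derivative D M t) (at t within {a..b})" for M t
  proof -
    have "(Q M has_real_derivative D M t) (at t)"
      unfolding Q_def D_def sum_distrib_left
      by (intro DERIV_sum conformal_flow_mode_derivative sol)
    then show ?thesis
      by (metis has_field_derivative_at_within has_real_derivative_iff_has_vector_derivative)
  qed
  then have int: "(D M has_integral (Q M b - Q M a)) {a..b}" for M
    by (intro fundamental_theorem_of_calculus \<open>a \<le> b\<close>)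
  \<comment> \<open>The leading 2 comes from \<open>D\<close>; \<open>B\<close> bounds the energy on
    the interval, and \<open>(B + inv_sq_sum) / 2\<close> the sum of the moduli.\<close>
  have bound: "norm (D M t) \<le> 2 * (B * ((B + inv_sq_sum) / 2)^2)" if "t \<in> {a..b}" for M t
  proof -
    have "(\<Sum>n. cmod (\<alpha> t n)) \<le> (B + inv_sq_sum) / 2"
      using h1_abs_summable(2)[OF h, of t] B[OF that] by simp
    then have "(\<Sum>n. cmod (\<alpha> t n))^2 \<le> ((B + inv_sq_sum) / 2)^2"
      by (intro power_mono suminf_nonneg h1_abs_summable h) auto
    then have "h1_energy (\<alpha> t) * (\<Sum>n. cmod (\<alpha> t n))^2 \<le> B * ((B + inv_sq_sum) / 2)^2"
      using B[OF that] B0 by (intro mult_mono) auto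
    then show ?thesis
      using resonance_partial_sums_le[OF h w, of t M] unfolding D_def by simp
  qed
  have "(\<lambda>M. D M t) \<longlonglongrightarrow> 0" for t
    using tendsto_mult_left[OF resonance_sums_real[OF h w aff, of t, unfolded sums_def], of 2]
    by (simp add: D_def)
  then have "(\<lambda>M. integral {a..b} (D M)) \<longlonglongrightarrow> integral {a..b} (\<lambda>_. 0)"
    using int bound
    by (intro dominated_convergence(2)[where h = "\<lambda>_. 2 * (B * ((B + inv_sq_sum) / 2)^2)"]) auto
  then have "(\<lambda>M. Q M b - Q M a) \<longlonglongrightarrow> 0"
    by (simp add: integral_unique[OF int])
  moreover have "(\<lambda>M. Q M b - Q M a) \<longlonglongrightarrow>
      (\<Sum>n. w n * (real n + 1) * (cmod (\<alpha> b n))^2) - (\<Sum>n. w n * (real n + 1) * (cmod (\<alpha> a n))^2)"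
    unfolding Q_def by (intro tendsto_diff summable_LIMSEQ weighted_summable h w)
  ultimately show ?thesis
    using LIMSEQ_unique by fastforce
qed

lemma conformal_flow_conserved:
  assumes "conformal_flow_solution \<alpha>" "\<And>n. \<bar>w n\<bar> \<le> real n + 1"
    "\<And>N n. n \<le> N \<Longrightarrow> w n + w (N - n) = w 0 + w N"
  shows "(\<Sum>n. w n * (real n + 1) * (cmod (\<alpha> s n))^2) = (\<Sum>n. w n * (real n + 1) * (cmod (\<alpha> t n))^2)"
proof (cases "s \<le> t")
  case True
  then show ?thesis by (intro conformal_flow_conserved_le assms)
next
  case False
  then have "t \<le> s" by simp
  then show ?thesis by (intro conformal_flow_conserved_le[symmetric] assms)
qed

section \<open>Distance to the orbit and stability of the ground state\<close>

text \<open>The scalar \<open>c\<close> covers the phase factors of the orbit.\<close>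

lemma ground_state_h1: "(\<lambda>n. c * ground_state n) \<in> h1"
  unfolding h1_def mem_Collect_eq
  by (rule summable_finite[of "{0}"]) (auto simp: ground_state_def)

text \<open>The infimum defining \<open>h1_dist\<close> is tested with the phase of \<open>a 0\<close>.\<close>
lemma h1_dist_ground_state_le:
  assumes "a \<in> h1"
  shows "h1_dist a (orbit ground_state) \<le>
    sqrt ((cmod (a 0) - 1)^2 + (\<Sum>n. (real n + 2)^2 * (cmod (a (Suc n)))^2))"
proof -
  define \<theta> where "\<theta> = Arg (a 0)"
  define b where "b n = exp (\<i> * of_real \<theta> + \<i> * of_real 0 * of_nat n) * ground_state n" for n
  have bo: "b \<in> orbit ground_state" unfolding orbit_def b_def by blast
  \<comment> \<open>A real infimum lies below its members only for sets bounded below; here 0 is a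
    bound.\<close>
  have bdd: "bdd_below ((\<lambda>\<beta>. h1_norm (\<lambda>n. a n - \<beta> n)) ` orbit ground_state)"
  proof (rule bdd_belowI2)
    fix \<beta> assume "\<beta> \<in> orbit ground_state"
    then obtain \<theta> \<mu> where "\<beta> = (\<lambda>n. exp (\<i> * of_real \<theta> + \<i> * of_real \<mu> * of_nat n) * ground_state n)"
      by (auto simp: orbit_def)
    \<comment> \<open>Only mode 0 is present, so the angle \<open>\<mu>\<close> disappears.\<close>
    also have "\<dots> = (\<lambda>n. exp (\<i> * of_real \<theta>) * ground_state n)"
      by (auto simp: ground_state_def)
    finally have "\<beta> \<in> h1" by (simp add: ground_state_h1)
    then show "0 \<le> h1_norm (\<lambda>n. a n - \<beta> n)"
      unfolding h1_norm_eq by (simp add: h1_energy_nonneg h1_diff assms)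
  qed
  have b0: "b 0 = exp (\<i> * of_real \<theta>)" and bS: "b (Suc n) = 0" for n
    by (simp_all add: b_def ground_state_def)
  \<comment> \<open>If \<open>a 0 = 0\<close>, both sides vanish whatever the phase.\<close>
  have a0: "a 0 = of_real (cmod (a 0)) * exp (\<i> * of_real \<theta>)"
    using Arg_eq[of "a 0"] by (cases "a 0 = 0") (simp_all add: \<theta>_def)
  have "a 0 - b 0 = of_real (cmod (a 0) - 1) * exp (\<i> * of_real \<theta>)"
    by (subst a0) (simp add: b0 algebra_simps)
  then have "cmod (a 0 - b 0) = \<bar>cmod (a 0) - 1\<bar>"
    by (simp add: norm_mult del: of_real_diff)
  then have c0: "(cmod (a 0 - b 0))^2 = (cmod (a 0) - 1)^2"
    by simp
  have "b \<in> h1"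
    using ground_state_h1[of "exp (\<i> * of_real \<theta>)"] by (simp add: b_def[abs_def])
  then have "(\<lambda>n. a n - b n) \<in> h1" using assms by (simp add: h1_diff)
  then have "h1_energy (\<lambda>n. a n - b n) =
      (\<Sum>n. (real (Suc n) + 1)^2 * (cmod (a (Suc n) - b (Suc n)))^2) + (cmod (a 0 - b 0))^2"
    unfolding h1_energy_def h1_def mem_Collect_eq by (subst suminf_split_head) auto
  then have "h1_norm (\<lambda>n. a n - b n) =
      sqrt ((cmod (a 0) - 1)^2 + (\<Sum>n. (real n + 2)^2 * (cmod (a (Suc n)))^2))"
    unfolding h1_norm_eq by (simp add: c0 bS algebra_simps)
  then show ?thesis
    unfolding h1_dist_def using cINF_lower[OF bdd bo] by simp
qed

text \<open>The zeroth mode moves at most \<open>4 * \<delta>\<close> away from modulus 1, while the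
  squared norm of the other modes stays below \<open>2 * \<delta>^2\<close>.\<close>

lemma conformal_flow_dist_le:
  assumes sol: "conformal_flow_solution \<alpha>"
    and close: "h1_norm (\<lambda>n. \<alpha> 0 n - ground_state n) \<le> \<delta>" and "0 < \<delta>" "\<delta> \<le> 1"
  shows "h1_dist (\<alpha> t) (orbit ground_state) \<le> 5 * \<delta>"
proof -
  have h: "\<alpha> t \<in> h1" for t
    using sol by (auto simp: conformal_flow_solution_def h1_continuous_def)
  \<comment> \<open>\<open>G\<close> and \<open>Q\<close> are the sums for the weights
    \<open>n\<close> and 1 over the modes from 1 on, with the index shifted by one. \<open>G\<close>
    is conserved by itself, because the weight \<open>n\<close> kills mode 0; \<open>Q\<close> only
    together with mode 0.\<close>
  define G where "G t = (\<Sum>n. (real n + 1) * (real n + 2) * (cmod (\<alpha> t (Suc n)))^2)" for t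
  define Q where "Q t = (\<Sum>n. (real n + 2) * (cmod (\<alpha> t (Suc n)))^2)" for t
  have sG: "summable (\<lambda>n. (real n + 1) * (real n + 2) * (cmod (\<alpha> t (Suc n)))^2)"
    and sQ: "summable (\<lambda>n. (real n + 2) * (cmod (\<alpha> t (Suc n)))^2)"
    and sT: "summable (\<lambda>n. (real n + 2)^2 * (cmod (\<alpha> t (Suc n)))^2)" for t
  proof -
    show "summable (\<lambda>n. (real n + 1) * (real n + 2) * (cmod (\<alpha> t (Suc n)))^2)"
      using summable_Suc_iff[THEN iffD2, OF weighted_summable[OF h, of real t]]
      by (simp add: algebra_simps)
    show "summable (\<lambda>n. (real n + 2) * (cmod (\<alpha> t (Suc n)))^2)"
      using summable_Suc_iff[THEN iffD2, OF weighted_summable[OF h, of "\<lambda>_. 1" t]]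
      by (simp add: algebra_simps)
    show "summable (\<lambda>n. (real n + 2)^2 * (cmod (\<alpha> t (Suc n)))^2)"
      using summable_Suc_iff[THEN iffD2, OF h[of t, unfolded h1_def mem_Collect_eq]]
      by (simp add: algebra_simps)
  qed
  have G: "G t = G 0"
  proof -
    have "G t = (\<Sum>n. real n * (real n + 1) * (cmod (\<alpha> t n))^2)" for t
      using suminf_split_head[OF weighted_summable[OF h, of real t]]
      by (simp add: G_def algebra_simps)
    then show ?thesis using conformal_flow_conserved[OF sol, of real t 0] by simp
  qed
  have Q: "(cmod (\<alpha> t 0))^2 + Q t = (cmod (\<alpha> 0 0))^2 + Q 0"
  proof -
    have "(cmod (\<alpha> t 0))^2 + Q t = (\<Sum>n. 1 * (real n + 1) * (cmod (\<alpha> t n))^2)" for t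
      using suminf_split_head[OF weighted_summable[OF h, of "\<lambda>_. 1" t]]
      by (simp add: Q_def algebra_simps)
    then show ?thesis using conformal_flow_conserved[OF sol, of "\<lambda>_. 1" t 0] by simp
  qed
  have QG: "0 \<le> Q t" "Q t \<le> G t" for t
  proof -
    show "0 \<le> Q t" unfolding Q_def by (intro suminf_nonneg sQ) simp
    show "Q t \<le> G t" unfolding Q_def G_def
      by (intro suminf_le sQ sG mult_right_mono) auto
  qed
  \<comment> \<open>Since \<open>n + 2 \<le> 2 * (n + 1)\<close>, the conserved \<open>G\<close>
    controls the full squared norm of the higher modes.\<close>
  have T: "(\<Sum>n. (real n + 2)^2 * (cmod (\<alpha> t (Suc n)))^2) \<le> 2 * G t"
    unfolding G_def suminf_mult[OF sG, symmetric] mult.assoc[symmetric]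
    by (intro suminf_le sT mult_right_mono summable_mult[OF sG, of 2, folded mult.assoc])
       (simp_all add: power2_eq_square)
  have d: "(\<lambda>n. \<alpha> 0 n - ground_state n) \<in> h1"
    using h1_diff[OF h ground_state_h1[of 1]] by simp
  have "sqrt (h1_energy (\<lambda>n. \<alpha> 0 n - ground_state n)) \<le> \<delta>"
    using close by (simp add: h1_norm_eq)
  then have "h1_energy (\<lambda>n. \<alpha> 0 n - ground_state n) \<le> \<delta>^2"
    by (rule sqrt_le_D)
  moreover have "h1_energy (\<lambda>n. \<alpha> 0 n - ground_state n) =
     (\<Sum>n. (real n + 2)^2 * (cmod (\<alpha> 0 (Suc n)))^2) + (cmod (\<alpha> 0 0 - 1))^2"
    using suminf_split_head[OF d[unfolded h1_def mem_Collect_eq]]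
    by (simp add: h1_energy_def ground_state_def algebra_simps)
  moreover have "G 0 \<le> (\<Sum>n. (real n + 2)^2 * (cmod (\<alpha> 0 (Suc n)))^2)"
    unfolding G_def
    by (intro suminf_le sT sG mult_right_mono) (auto simp: power2_eq_square)
  ultimately have G0: "G 0 + (cmod (\<alpha> 0 0 - 1))^2 \<le> \<delta>^2" by simp
  have "0 \<le> G 0" using QG[of 0] by simp
  with G0 have "(cmod (\<alpha> 0 0 - 1))^2 \<le> \<delta>^2" by simp
  then have "cmod (\<alpha> 0 0 - 1) \<le> \<delta>"
    using \<open>0 < \<delta>\<close> by (simp add: abs_le_square_iff[symmetric])
  then have x: "\<bar>cmod (\<alpha> 0 0) - 1\<bar> \<le> \<delta>"
    using norm_triangle_ineq3[of "\<alpha> 0 0" 1] by simp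
  have GD: "G 0 \<le> \<delta>^2" using G0 zero_le_power2[of "cmod (\<alpha> 0 0 - 1)"] by linarith
  have d2: "\<delta>^2 \<le> \<delta>" using assms(3,4) by (simp add: power2_eq_square)
  have fac: "\<bar>r^2 - 1\<bar> = \<bar>r - 1\<bar> * \<bar>r + 1\<bar>" for r :: real
    unfolding abs_mult[symmetric] by (simp add: power2_eq_square algebra_simps)
  \<comment> \<open>This recovers the modulus from its square without taking a root of
    \<open>\<delta>\<close>.\<close>
  have sq: "\<bar>r - 1\<bar> \<le> \<bar>r^2 - 1\<bar>" if "0 \<le> r" for r :: real
  proof -
    have "\<bar>r^2 - 1\<bar> = \<bar>r - 1\<bar> * \<bar>r + 1\<bar>"
      by (rule fac)
    also have "\<dots> \<ge> \<bar>r - 1\<bar> * 1" using that by (intro mult_left_mono) auto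
    finally show ?thesis by simp
  qed
  have "\<bar>(cmod (\<alpha> 0 0))^2 - 1\<bar> = \<bar>cmod (\<alpha> 0 0) - 1\<bar> * \<bar>cmod (\<alpha> 0 0) + 1\<bar>"
    by (rule fac)
  \<comment> \<open>The second factor is at most \<open>2 + \<delta> \<le> 3\<close>.\<close>
  also have "\<dots> \<le> \<delta> * 3"
    using x assms(3,4) by (intro mult_mono) auto
  \<comment> \<open>Both \<open>Q 0\<close> and \<open>Q t\<close> lie between 0 and
    \<open>G 0 \<le> \<delta>^2 \<le> \<delta>\<close>, so their difference adds at most one more
    \<open>\<delta>\<close>.\<close>
  finally have "\<bar>(cmod (\<alpha> t 0))^2 - 1\<bar> \<le> 4 * \<delta>"
    using Q QG[of 0] QG[of t] G GD d2 by linarith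
  then have "\<bar>cmod (\<alpha> t 0) - 1\<bar> \<le> 4 * \<delta>"
    using sq[of "cmod (\<alpha> t 0)"] by simp
  then have "(cmod (\<alpha> t 0) - 1)^2 \<le> (4 * \<delta>)^2"
    using \<open>0 < \<delta>\<close> by (simp only: abs_le_square_iff[symmetric])
  \<comment> \<open>The two contributions add up to \<open>18 * \<delta>^2\<close>, below
    \<open>25 * \<delta>^2\<close>.\<close>
  then have "(cmod (\<alpha> t 0) - 1)^2 + (\<Sum>n. (real n + 2)^2 * (cmod (\<alpha> t (Suc n)))^2) \<le> (5 * \<delta>)^2"
    using T G GD zero_le_power2[of "\<delta>"]
    unfolding power_mult_distrib power2_eq_square[of "4::real"] power2_eq_square[of "5::real"]
    by linarith
  then have "sqrt ((cmod (\<alpha> t 0) - 1)^2 + (\<Sum>n. (real n + 2)^2 * (cmod (\<alpha> t (Suc n)))^2)) \<le> 5 * \<delta>"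
    using \<open>0 < \<delta>\<close> by (intro real_le_lsqrt) auto
  then show ?thesis
    using h1_dist_ground_state_le[OF h, of t] by linarith
qed

theorem theorem3:
  shows "\<exists>\<epsilon>0::real. \<epsilon>0 > 0 \<and> (\<forall>\<epsilon>::real. 0 < \<epsilon> \<and> \<epsilon> < \<epsilon>0 \<longrightarrow>
    (\<exists>\<delta>::real. \<delta> > 0 \<and>
      (\<forall>a \<in> h1. h1_norm (\<lambda>n. a n - ground_state n) \<le> \<delta> \<longrightarrow>
        (\<forall>\<alpha>. conformal_flow_solution \<alpha> \<and> \<alpha> 0 = a \<longrightarrow>
          (\<forall>t. h1_dist (\<alpha> t) (orbit ground_state) \<le> \<epsilon>)))))"
proof (rule exI[of _ 1], intro conjI allI impI)
  fix \<epsilon> :: real assume e: "0 < \<epsilon> \<and> \<epsilon> < 1"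
  show "\<exists>\<delta>::real. \<delta> > 0 \<and>
      (\<forall>a \<in> h1. h1_norm (\<lambda>n. a n - ground_state n) \<le> \<delta> \<longrightarrow>
        (\<forall>\<alpha>. conformal_flow_solution \<alpha> \<and> \<alpha> 0 = a \<longrightarrow>
          (\<forall>t. h1_dist (\<alpha> t) (orbit ground_state) \<le> \<epsilon>)))"
  \<comment> \<open>The choice inverts the bound \<open>5 * \<delta>\<close>; the threshold 1 for
    \<open>\<epsilon>\<close> ensures \<open>\<delta> \<le> 1\<close>.\<close>
  proof (rule exI[of _ "\<epsilon> / 5"], intro conjI ballI allI impI)
    fix a \<alpha> t
    assume "h1_norm (\<lambda>n. a n - ground_state n) \<le> \<epsilon> / 5" "conformal_flow_solution \<alpha> \<and> \<alpha> 0 = a"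
    then show "h1_dist (\<alpha> t) (orbit ground_state) \<le> \<epsilon>"
      using conformal_flow_dist_le[of \<alpha> "\<epsilon> / 5" t] e by simp
  qed (use e in simp)
qed simp

end
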